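(* Let $f:X\to X$ be a continuous map on a compact metric space with $h_{\mathrm{top}}(f)<\infty$ such that $\mu\mapsto h_\mu(f)$ is upper semi-continuous on $\mathcal{M}$. Let $\Phi\in C(X,\mathbb{R}^m)$ and let $(\Phi_{\epsilon_n})_n$ be an approximating sequence of $\Phi$. Let $w_0\in\operatorname{int}\mathrm{Rot}(\Phi)$, $\alpha\ge1$ and $r=2\sqrt m$. Then (i) $\displaystyle\lim_{n\to\infty}h^l_{\Phi_{\epsilon_n}}(w_0,\alpha\epsilon_n)=\mathcal{H}_\Phi(w_0)=\lim_{n\to\infty}h^u_{\Phi_{\epsilon_n}}(w_0,\alpha\epsilon_n)$; (ii) if $\alpha>r$ and $\epsilon_{n+1}<\frac{\alpha-r}{\alpha r}\,\epsilon_n$ for all $n\in\mathbb{N}$, then $(h^l_{\Phi_{\epsilon_n}}(w_0,\alpha\epsilon_n))_n$ is a (not necessarily strictly) increasing sequence for $n$ sufficiently large.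
   Context: $\mathcal{M}$ is the set of $f$-invariant Borel probability measures on $X$ with the weak$^*$ topology; $h_\mu(f)$ is the measure-theoretic entropy. For $\Psi\in C(X,\mathbb{R}^m)$: $\mathrm{rv}_\Psi(\mu)=\int\Psi\,d\mu$ (componentwise), $\mathrm{Rot}(\Psi)=\{\mathrm{rv}_\Psi(\mu):\mu\in\mathcal{M}\}$, and $\mathcal{H}_\Psi(w)=\sup\{h_\mu(f):\mu\in\mathcal{M},\ \mathrm{rv}_\Psi(\mu)=w\}$ for $w\in\mathrm{Rot}(\Psi)$. An approximating sequence of $\Phi$ is a sequence $\Phi_{\epsilon_n}\in C(X,\mathbb{R}^m)$ with $\epsilon_n\to0$ and $\|\Phi_{\epsilon_n}-\Phi\|_\infty<\epsilon_n$ for all $n$. For $w_0\in\mathbb{R}^m$, $s>0$, $$h^u_\Psi(w_0,s)=\sup\{\mathcal{H}_\Psi(w):w\in\overline{B}(w_0,s)\cap\mathrm{Rot}(\Psi)\},\quad h^l_\Psi(w_0,s)=\inf\{\mathcal{H}_\Psi(w):w\in\overline{B}(w_0,s)\cap\mathrm{Rot}(\Psi)\},$$ with the conventions $\sup\emptyset=+\infty$, $\inf\emptyset=-\infty$. *)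

theory Defs
  imports "HOL-Probability.Probability"
begin

text \<open>The phase space is a type \<open>'a::metric_space\<close>; its compactness is the hypothesis
  \<open>compact (UNIV :: 'a set)\<close>. Entropies are extended reals.\<close>

section \<open>Invariant measures and the weak* topology\<close>

definition inv_measures :: "('a::topological_space \<Rightarrow> 'a) \<Rightarrow> 'a measure set" where
  "inv_measures f = {\<mu>. sets \<mu> = sets borel \<and> prob_space \<mu> \<and> distr \<mu> borel f = \<mu>}"

text \<open>The coarsest topology on the invariant measures for which \<open>\<mu> \<mapsto> \<integral>\<phi> d\<mu>\<close> is continuous
  for every continuous \<open>\<phi>\<close>.\<close>

definition weak_star :: "('a::topological_space \<Rightarrow> 'a) \<Rightarrow> 'a measure topology" where
  "weak_star f = topology_generated_by
     {{\<mu> \<in> inv_measures f. (\<integral>x. \<phi> x \<partial>\<mu>) \<in> U} | (\<phi> :: 'a \<Rightarrow> real) U.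
        continuous_on UNIV \<phi> \<and> open U}"

definition upper_semicontinuous_map :: "'b topology \<Rightarrow> ('b \<Rightarrow> ereal) \<Rightarrow> bool" where
  "upper_semicontinuous_map T h \<longleftrightarrow> (\<forall>c. openin T {x \<in> topspace T. h x < c})"

section \<open>Measure-theoretic (Kolmogorov--Sinai) entropy\<close>

definition finite_partitions :: "'a measure \<Rightarrow> 'a set set set" where
  "finite_partitions \<mu> = {P. finite P \<and> partition_on (space \<mu>) P \<and> P \<subseteq> sets \<mu>}"

text \<open>The usual convention \<open>0 log 0 = 0\<close> holds automatically.\<close>

definition partition_entropy :: "'a measure \<Rightarrow> 'a set set \<Rightarrow> real" where
  "partition_entropy \<mu> P = - (\<Sum>A\<in>P. measure \<mu> A * ln (measure \<mu> A))"

definition pull_partition :: "('a \<Rightarrow> 'a) \<Rightarrow> 'a set set \<Rightarrow> 'a set set" where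
  "pull_partition g P = (\<lambda>A. g -` A) ` P - {{}}"

text \<open>The join of \<open>P, f\<^sup>-\<^sup>1 P, \<dots>, f\<^bsup>-(n-1)\<^esup> P\<close>.\<close>

definition iterated_partition :: "('a \<Rightarrow> 'a) \<Rightarrow> 'a set set \<Rightarrow> nat \<Rightarrow> 'a set set" where
  "iterated_partition f P n = common_refinement ((\<lambda>k. pull_partition (f ^^ k) P) ` {..<n})"

text \<open>For an invariant measure the limit exists, by subadditivity.\<close>

definition entropy_wrt :: "('a \<Rightarrow> 'a) \<Rightarrow> 'a measure \<Rightarrow> 'a set set \<Rightarrow> real" where
  "entropy_wrt f \<mu> P = lim (\<lambda>n. partition_entropy \<mu> (iterated_partition f P n) / real n)"

definition measure_entropy :: "('a \<Rightarrow> 'a) \<Rightarrow> 'a measure \<Rightarrow> ereal" where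
  "measure_entropy f \<mu> = (SUP P\<in>finite_partitions \<mu>. ereal (entropy_wrt f \<mu> P))"

section \<open>Topological entropy\<close>

definition bowen_dist :: "('a::metric_space \<Rightarrow> 'a) \<Rightarrow> nat \<Rightarrow> 'a \<Rightarrow> 'a \<Rightarrow> real" where
  "bowen_dist f n x y = Max ((\<lambda>k. dist ((f ^^ k) x) ((f ^^ k) y)) ` {..<n})"

definition is_separated :: "('a::metric_space \<Rightarrow> 'a) \<Rightarrow> nat \<Rightarrow> real \<Rightarrow> 'a set \<Rightarrow> bool" where
  "is_separated f n e F \<longleftrightarrow> (\<forall>x\<in>F. \<forall>y\<in>F. x \<noteq> y \<longrightarrow> bowen_dist f n x y > e)"

text \<open>On a compact space, for continuous \<open>f\<close>, \<open>n \<ge> 1\<close> and \<open>e > 0\<close>, the cardinalities below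
  are bounded, so the maximum is attained. Values at \<open>n = 0\<close> do not affect \<open>top_entropy\<close>.\<close>

definition max_separated :: "('a::metric_space \<Rightarrow> 'a) \<Rightarrow> nat \<Rightarrow> real \<Rightarrow> nat" where
  "max_separated f n e = Max {card F | F. finite F \<and> is_separated f n e F}"

definition top_entropy :: "('a::metric_space \<Rightarrow> 'a) \<Rightarrow> ereal" where
  "top_entropy f = Lim (at_right 0)
     (\<lambda>e. limsup (\<lambda>n. ereal (ln (real (max_separated f n e)) / real n)))"

section \<open>Rotation vectors and localized entropy\<close>

definition rv :: "('a \<Rightarrow> real ^ 'm) \<Rightarrow> 'a measure \<Rightarrow> real ^ 'm" where
  "rv \<Psi> \<mu> = (\<chi> i. \<integral>x. \<Psi> x $ i \<partial>\<mu>)"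

definition Rot :: "('a::topological_space \<Rightarrow> 'a) \<Rightarrow> ('a \<Rightarrow> real ^ 'm) \<Rightarrow> (real ^ 'm) set" where
  "Rot f \<Psi> = rv \<Psi> ` inv_measures f"

definition loc_entropy ::
  "('a::topological_space \<Rightarrow> 'a) \<Rightarrow> ('a \<Rightarrow> real ^ 'm) \<Rightarrow> real ^ 'm \<Rightarrow> ereal" where
  "loc_entropy f \<Psi> w = (SUP \<mu>\<in>{\<mu> \<in> inv_measures f. rv \<Psi> \<mu> = w}. measure_entropy f \<mu>)"

text \<open>In \<open>h_upper\<close> and \<open>h_lower\<close> the empty set gets the conventions
  \<open>sup \<emptyset> = +\<infinity>\<close>, \<open>inf \<emptyset> = -\<infinity>\<close>, opposite to those of \<open>Sup\<close> and \<open>Inf\<close> on \<open>ereal\<close>.\<close>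

definition h_upper ::
  "('a::topological_space \<Rightarrow> 'a) \<Rightarrow> ('a \<Rightarrow> real ^ 'm) \<Rightarrow> real ^ 'm \<Rightarrow> real \<Rightarrow> ereal" where
  "h_upper f \<Psi> w0 s =
     (if cball w0 s \<inter> Rot f \<Psi> = {} then \<infinity>
      else (SUP w\<in>cball w0 s \<inter> Rot f \<Psi>. loc_entropy f \<Psi> w))"

definition h_lower ::
  "('a::topological_space \<Rightarrow> 'a) \<Rightarrow> ('a \<Rightarrow> real ^ 'm) \<Rightarrow> real ^ 'm \<Rightarrow> real \<Rightarrow> ereal" where
  "h_lower f \<Psi> w0 s =
     (if cball w0 s \<inter> Rot f \<Psi> = {} then -\<infinity>
      else (INF w\<in>cball w0 s \<inter> Rot f \<Psi>. loc_entropy f \<Psi> w))"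

section \<open>Approximating sequences\<close>

text \<open>The supremum norm, with respect to the Euclidean norm on the target. It is used only for
  bounded functions.\<close>

definition sup_norm :: "('a \<Rightarrow> real ^ 'm) \<Rightarrow> real" where
  "sup_norm \<Psi> = (SUP x. norm (\<Psi> x))"

text \<open>\<open>\<Phi>s n\<close> stands for the function indexed by \<open>\<epsilon> n\<close>; positivity of \<open>\<epsilon> n\<close> is implied.\<close>

definition approximating_sequence ::
  "('a::topological_space \<Rightarrow> real ^ 'm) \<Rightarrow> (nat \<Rightarrow> real) \<Rightarrow> (nat \<Rightarrow> 'a \<Rightarrow> real ^ 'm) \<Rightarrow> bool" where
  "approximating_sequence \<Phi> \<epsilon> \<Phi>s \<longleftrightarrow>
     \<epsilon> \<longlonglongrightarrow> 0 \<and>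
     (\<forall>n. continuous_on UNIV (\<Phi>s n) \<and> sup_norm (\<lambda>x. \<Phi>s n x - \<Phi> x) < \<epsilon> n)"

end

theory Submission
  imports Defs
begin

text \<open>Everything follows from concavity and nonnegativity of the measure-theoretic entropy. By
  concavity, the rotation vectors of the measures of entropy at least \<open>c\<close> form a convex set.
  If such a set comes within \<open>d\<close> of every point of a sphere of radius \<open>R\<close>, then, by separation,
  it contains the open ball of radius \<open>R - d\<close> with the same centre; passing from \<open>\<Phi>\<close> to
  \<open>\<Phi>s n\<close> moves rotation vectors by at most \<open>\<epsilon> n\<close>. Applied to a small sphere of measures
  obtained by averaging a nearly optimal measure at \<open>w0\<close> with measures around it, this bounds
  \<open>h_lower\<close> from below. Applied to the sphere of radius \<open>\<alpha> * \<epsilon> n\<close> and the step from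
  \<open>\<Phi>s n\<close> to \<open>\<Phi>s (Suc n)\<close> it gives the monotonicity, since the condition on \<open>\<epsilon>\<close> implies
  \<open>(\<alpha> + 1) * \<epsilon> (Suc n) < (\<alpha> - 1) * \<epsilon> n\<close>.\<close>

section \<open>Subadditive sequences\<close>

text \<open>Fekete's argument: writing \<open>n = q * k + r\<close> with \<open>r < k\<close>,
  subadditivity bounds \<open>a n / real n\<close> by \<open>a k / real k\<close> plus a term that
  vanishes as \<open>n\<close> grows, so the quotients tend to their infimum.\<close>

lemma fekete_convergent:
  fixes a :: "nat \<Rightarrow> real"
  assumes nonneg: "\<And>n. 0 \<le> a n"
    and subadd: "\<And>m n. a (m + n) \<le> a m + a n"
  shows "convergent (\<lambda>n. a n / real n)"
proof -
  \<comment> \<open>Index 0 is left out, since division by zero would put the value 0 into the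
    infimum.\<close>
  define L where "L = (INF n\<in>{1..}. a n / real n)"
  have bdd: "bdd_below ((\<lambda>n. a n / real n) ` {1..})"
    using nonneg by (auto intro!: bdd_belowI[of _ 0])
  have mult: "a (q * k + r) \<le> real q * a k + a r" for q k r
  proof (induction q)
    case (Suc q)
    have "a (Suc q * k + r) \<le> a k + a (q * k + r)"
      using subadd[of k "q * k + r"] by (simp add: add.assoc)
    with Suc show ?case by (simp add: algebra_simps)
  qed simp
  have "(\<lambda>n. a n / real n) \<longlonglongrightarrow> L"
  proof (rule order_tendstoI)
    fix y assume "y < L"
    have "L \<le> a n / real n" if "n \<ge> 1" for n
      unfolding L_def by (rule cINF_lower[OF bdd]) (use that in auto)
    with \<open>y < L\<close> show "\<forall>\<^sub>F n in sequentially. y < a n / real n"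
      by (intro eventually_sequentiallyI[of 1]) force
  next
    fix y assume "L < y"
    then obtain k where k: "k \<ge> 1" "a k / real k < y"
      unfolding L_def using cInf_lessD[of "(\<lambda>n. a n / real n) ` {1..}" y] by auto
    \<comment> \<open>A bound, independent of \<open>n\<close>, for the contribution of every
      remainder \<open>n mod k\<close>.\<close>
    define B where "B = (\<Sum>r<k. a r)"
    have B: "a r \<le> B" if "r < k" for r
      unfolding B_def by (rule member_le_sum) (use that nonneg in auto)
    have bound: "a n / real n \<le> a k / real k + B / real n" if "n \<ge> 1" for n
    proof -
      have "a n \<le> real (n div k) * a k + B"
        using mult[of "n div k" k "n mod k"] B[of "n mod k"] k by simp
      also have "real (n div k) * a k \<le> (real n / real k) * a k"
        using nonneg by (intro mult_right_mono of_nat_div_le_of_nat)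
      finally have "a n / real n \<le> (real n / real k * a k + B) / real n"
        by (intro divide_right_mono) auto
      also have "\<dots> = a k / real k + B / real n"
        using that by (simp add: field_simps)
      finally show ?thesis .
    qed
    have "(\<lambda>n. a k / real k + B / real n) \<longlonglongrightarrow> a k / real k + 0"
      by (intro tendsto_intros lim_const_over_n)
    then have "\<forall>\<^sub>F n in sequentially. a k / real k + B / real n < y"
      using k(2) by (intro order_tendstoD) auto
    with eventually_ge_at_top[of 1] show "\<forall>\<^sub>F n in sequentially. a n / real n < y"
      by eventually_elim (use bound in force)
  qed
  then show ?thesis
    by (rule convergentI)
qed

section \<open>Entropy of labellings\<close>

text \<open>A finite partition is represented by a labelling of the points, the parts being the fibres.
  Joins become pairings, and coarsening becomes composition.\<close>

definition label_entropy :: "'a measure \<Rightarrow> ('a \<Rightarrow> 'b) \<Rightarrow> real" where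
  "label_entropy \<mu> g = - (\<Sum>y\<in>range g. measure \<mu> (g -` {y}) * ln (measure \<mu> (g -` {y})))"

definition itinerary :: "('a \<Rightarrow> 'a) \<Rightarrow> ('a \<Rightarrow> 'b) \<Rightarrow> nat \<Rightarrow> 'a \<Rightarrow> 'b list" where
  "itinerary f g n x = map (\<lambda>k. g ((f ^^ k) x)) [0..<n]"

definition entropy_rate :: "('a \<Rightarrow> 'a) \<Rightarrow> 'a measure \<Rightarrow> ('a \<Rightarrow> 'b) \<Rightarrow> real" where
  "entropy_rate f \<mu> g = lim (\<lambda>n. label_entropy \<mu> (itinerary f g n) / real n)"

text \<open>The labelling attached to a partition: the label of a point is its own part. The
  description is meaningful only when the parts are disjoint and cover.\<close>

definition cell :: "'a set set \<Rightarrow> 'a \<Rightarrow> 'a set" where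
  "cell P x = (THE A. A \<in> P \<and> x \<in> A)"

text \<open>The way back from labellings to partitions. Only attained values are used, so no part is
  empty.\<close>

definition fibres :: "('a \<Rightarrow> 'b) \<Rightarrow> 'a set set" where
  "fibres g = range (\<lambda>x. g -` {g x})"

lemma itinerary_add: "itinerary f g (m + n) x = itinerary f g m x @ itinerary f g n ((f ^^ m) x)"
proof -
  have "[0..<m + n] = [0..<m] @ map (\<lambda>k. k + m) [0..<n]"
    using upt_add_eq_append[of 0 m n] map_add_upt[of m n] by (simp add: add.commute)
  moreover have "(f ^^ k) ((f ^^ m) x) = (f ^^ (k + m)) x" for k
    by (simp add: funpow_add)
  ultimately show ?thesis
    by (simp add: itinerary_def comp_def)
qed

lemma itinerary_Suc: "itinerary f g (Suc n) x = g x # itinerary f g n (f x)"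
  using itinerary_add[of f g 1 n x] by (simp add: itinerary_def)

lemma itinerary_comp: "itinerary f (\<phi> \<circ> g) n = map \<phi> \<circ> itinerary f g n"
  by (auto simp: itinerary_def fun_eq_iff)

lemma simple_function_itinerary:
  assumes f: "f \<in> measurable \<mu> \<mu>" and g: "simple_function \<mu> g"
  shows "simple_function \<mu> (itinerary f g n)"
proof (induction n)
  case 0
  have "itinerary f g 0 = (\<lambda>_. [])"
    by (auto simp: itinerary_def)
  then show ?case by simp
next
  case (Suc n)
  have "simple_function \<mu> ((\<lambda>(a, l). a # l) \<circ> (\<lambda>x. (g x, itinerary f g n (f x))))"
    by (rule simple_function_compose[OF simple_function_Pair[OF g simple_function_comp[OF f Suc]]])
  moreover have "itinerary f g (Suc n) = (\<lambda>(a, l). a # l) \<circ> (\<lambda>x. (g x, itinerary f g n (f x)))"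
    by (auto simp: itinerary_Suc)
  ultimately show ?case by metis
qed

lemma partition_entropy_fibres: "partition_entropy \<mu> (fibres g) = label_entropy \<mu> g"
proof -
  have "fibres g = (\<lambda>y. g -` {y}) ` range g" "inj_on (\<lambda>y. g -` {y}) (range g)"
    by (auto simp: fibres_def inj_on_def)
  then show ?thesis
    by (simp add: partition_entropy_def label_entropy_def sum.reindex)
qed

lemma label_entropy_eq_sum_superset:
  assumes "range g \<subseteq> B" "finite B"
  shows "label_entropy \<mu> g = - (\<Sum>y\<in>B. measure \<mu> (g -` {y}) * ln (measure \<mu> (g -` {y})))"
proof -
  have "g -` {y} = {}" if "y \<in> B - range g" for y
    using that by auto
  then show ?thesis
    unfolding label_entropy_def using assms by (auto intro!: sum.mono_neutral_left)
qed

lemma label_entropy_nonneg: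
  assumes "prob_space \<mu>"
  shows "0 \<le> label_entropy \<mu> g"
proof -
  interpret prob_space \<mu> by fact
  have "measure \<mu> A * ln (measure \<mu> A) \<le> 0" for A
    by (cases "measure \<mu> A = 0") (auto intro!: mult_nonneg_nonpos simp: less_le ln_le_zero_iff)
  then show ?thesis
    by (simp add: label_entropy_def sum_nonpos)
qed

text \<open>Base \<open>exp 1\<close> turns the library's logarithm into \<open>ln\<close>, which
  gives access to data processing and the chain rule.\<close>

lemma label_entropy_eq_entropy:
  assumes "prob_space \<mu>" "space \<mu> = UNIV" "simple_function \<mu> g"
  shows "label_entropy \<mu> g = prob_space.entropy \<mu> (exp 1) (count_space (g ` space \<mu>)) g"
proof -
  interpret information_space \<mu> "exp 1"
    using assms(1) by (simp add: information_space_def information_space_axioms_def)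
  show ?thesis
    using entropy_simple_distributed[OF simple_distributedI[OF assms(3) measure_nonneg refl]] assms(2)
    by (simp add: label_entropy_def log_def)
qed

text \<open>Data processing: merging labels loses information.\<close>

lemma label_entropy_comp_le:
  assumes "prob_space \<mu>" "space \<mu> = UNIV" "simple_function \<mu> g"
  shows "label_entropy \<mu> (\<phi> \<circ> g) \<le> label_entropy \<mu> g"
proof -
  interpret information_space \<mu> "exp 1"
    using assms(1) by (simp add: information_space_def information_space_axioms_def)
  show ?thesis
    using entropy_data_processing[OF assms(3), of \<phi>] assms
    by (simp add: label_entropy_eq_entropy simple_function_compose)
qed

text \<open>The chain rule, together with the fact that conditioning does not increase
  entropy.\<close>

lemma label_entropy_pair_le:
  assumes "prob_space \<mu>" "space \<mu> = UNIV" "simple_function \<mu> g" "simple_function \<mu> h"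
  shows "label_entropy \<mu> (\<lambda>x. (g x, h x)) \<le> label_entropy \<mu> g + label_entropy \<mu> h"
proof -
  interpret information_space \<mu> "exp 1"
    using assms(1) by (simp add: information_space_def information_space_axioms_def)
  show ?thesis
    using entropy_chain_rule[OF assms(3,4)] conditional_entropy_less_eq_entropy[OF assms(4,3)] assms
    by (simp add: label_entropy_eq_entropy simple_function_Pair)
qed

section \<open>Invariant measures\<close>

lemma inv_measuresD:
  assumes "\<mu> \<in> inv_measures f"
  shows "prob_space \<mu>" "space \<mu> = UNIV" "sets \<mu> = sets borel" "distr \<mu> borel f = \<mu>"
  using assms sets_eq_imp_space_eq[of \<mu> borel] by (auto simp: inv_measures_def)

text \<open>The fibres of the composite are the preimages under \<open>f\<close> of the fibres of
  \<open>g\<close>. Labels that the composite misses have empty fibres and contribute 0, so both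
  sums may run over \<open>range g\<close>.\<close>

lemma label_entropy_comp_invariant:
  assumes \<mu>: "\<mu> \<in> inv_measures f" and f: "f \<in> borel_measurable borel" and g: "simple_function \<mu> g"
  shows "label_entropy \<mu> (\<lambda>x. g (f x)) = label_entropy \<mu> g"
proof -
  note D = inv_measuresD[OF \<mu>]
  have [measurable_cong]: "sets \<mu> = sets borel" by (rule D)
  have "measure \<mu> ((\<lambda>x. g (f x)) -` {y}) = measure \<mu> (g -` {y})" for y
  proof -
    have "g -` {y} \<in> sets borel"
      using simple_functionD(2)[OF g, of "{y}"] D by simp
    moreover have "f \<in> measurable \<mu> borel"
      using f D(3) measurable_cong_sets[of \<mu> borel borel borel] by auto
    ultimately have "measure (distr \<mu> borel f) (g -` {y}) = measure \<mu> (f -` (g -` {y}))"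
      using D(2) by (subst measure_distr) auto
    then show ?thesis
      by (simp add: D(4) vimage_def)
  qed
  moreover have "finite (range g)"
    using simple_functionD(1)[OF g] D by simp
  moreover have "range (\<lambda>x. g (f x)) \<subseteq> range g" by auto
  ultimately show ?thesis
    using label_entropy_eq_sum_superset[of "\<lambda>x. g (f x)" "range g" \<mu>]
    by (simp only: label_entropy_def)
qed

lemma funpow_invariant:
  assumes "\<mu> \<in> inv_measures f" and f: "f \<in> borel_measurable borel"
  shows "\<mu> \<in> inv_measures (f ^^ n)" "f ^^ n \<in> borel_measurable borel"
proof -
  note D = inv_measuresD[OF assms(1)]
  show m: "f ^^ n \<in> borel_measurable borel" for n
    by (induction n) (auto intro!: measurable_compose[OF _ f] simp: comp_def id_def)
  have "distr \<mu> borel (f ^^ n) = \<mu>"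
  proof (induction n)
    case 0
    then show ?case using D by (simp add: id_def distr_id2)
  next
    case (Suc n)
    have "f ^^ n \<in> measurable \<mu> borel"
      using m D(3) measurable_cong_sets[of \<mu> borel borel borel] by auto
    then have "distr \<mu> borel (f ^^ Suc n) = distr (distr \<mu> borel (f ^^ n)) borel f"
      by (simp add: distr_distr[OF f])
    with Suc D show ?case by metis
  qed
  then show "\<mu> \<in> inv_measures (f ^^ n)"
    using D by (simp add: inv_measures_def)
qed

text \<open>An itinerary of length \<open>m + n\<close> is an itinerary of length \<open>m\<close>
  followed by one of length \<open>n\<close> started at time \<open>m\<close>; by invariance the
  delay does not change the entropy. Hence the entropies are subadditive in the length.\<close>

lemma entropy_rate_LIMSEQ:
  assumes \<mu>: "\<mu> \<in> inv_measures f" and f: "f \<in> borel_measurable borel" and g: "simple_function \<mu> g"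
  shows "(\<lambda>n. label_entropy \<mu> (itinerary f g n) / real n) \<longlonglongrightarrow> entropy_rate f \<mu> g"
proof -
  note D = inv_measuresD[OF \<mu>]
  have f': "f \<in> measurable \<mu> \<mu>"
    using f D(3) measurable_cong_sets[of \<mu> borel \<mu> borel] by auto
  have sf: "simple_function \<mu> (itinerary f g n)" for n
    by (rule simple_function_itinerary[OF f' g])
  have "convergent (\<lambda>n. label_entropy \<mu> (itinerary f g n) / real n)"
  proof (rule fekete_convergent)
    show "0 \<le> label_entropy \<mu> (itinerary f g n)" for n
      by (rule label_entropy_nonneg[OF D(1)])
    fix m n
    note inv = funpow_invariant[OF \<mu> f, of m]
    have "f ^^ m \<in> measurable \<mu> \<mu>"
      using inv(2) D(3) measurable_cong_sets[of \<mu> borel \<mu> borel] by auto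
    then have sfm: "simple_function \<mu> (\<lambda>x. itinerary f g n ((f ^^ m) x))"
      by (rule simple_function_comp[OF _ sf])
    have "itinerary f g (m + n)
        = (\<lambda>(k, l). k @ l) \<circ> (\<lambda>x. (itinerary f g m x, itinerary f g n ((f ^^ m) x)))"
      by (auto simp: itinerary_add)
    then have "label_entropy \<mu> (itinerary f g (m + n))
        \<le> label_entropy \<mu> (\<lambda>x. (itinerary f g m x, itinerary f g n ((f ^^ m) x)))"
      using label_entropy_comp_le[OF D(1,2) simple_function_Pair[OF sf sfm]] by simp
    also have "\<dots> \<le> label_entropy \<mu> (itinerary f g m)
        + label_entropy \<mu> (\<lambda>x. itinerary f g n ((f ^^ m) x))"
      by (rule label_entropy_pair_le[OF D(1,2) sf sfm])
    also have "label_entropy \<mu> (\<lambda>x. itinerary f g n ((f ^^ m) x)) = label_entropy \<mu> (itinerary f g n)"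
      by (rule label_entropy_comp_invariant[OF inv sf])
    finally show "label_entropy \<mu> (itinerary f g (m + n))
      \<le> label_entropy \<mu> (itinerary f g m) + label_entropy \<mu> (itinerary f g n)" .
  qed
  then show ?thesis
    unfolding entropy_rate_def by (simp add: convergent_LIMSEQ_iff)
qed

lemma entropy_rate_nonneg:
  assumes "\<mu> \<in> inv_measures f" "f \<in> borel_measurable borel" "simple_function \<mu> g"
  shows "0 \<le> entropy_rate f \<mu> g"
  by (rule LIMSEQ_le_const[OF entropy_rate_LIMSEQ[OF assms]])
    (auto intro!: divide_nonneg_nonneg label_entropy_nonneg inv_measuresD[OF assms(1)])

lemma entropy_rate_comp_le:
  assumes \<mu>: "\<mu> \<in> inv_measures f" and f: "f \<in> borel_measurable borel" and g: "simple_function \<mu> g"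
  shows "entropy_rate f \<mu> (\<phi> \<circ> g) \<le> entropy_rate f \<mu> g"
proof (rule LIMSEQ_le[OF entropy_rate_LIMSEQ[OF \<mu> f simple_function_compose[OF g]]
      entropy_rate_LIMSEQ[OF \<mu> f g]])
  note D = inv_measuresD[OF \<mu>]
  have f': "f \<in> measurable \<mu> \<mu>"
    using f D(3) measurable_cong_sets[of \<mu> borel \<mu> borel] by auto
  show "\<exists>N. \<forall>n\<ge>N. label_entropy \<mu> (itinerary f (\<phi> \<circ> g) n) / real n
      \<le> label_entropy \<mu> (itinerary f g n) / real n"
    by (auto simp: itinerary_comp
        intro!: divide_right_mono label_entropy_comp_le D simple_function_itinerary f' g)
qed

section \<open>Partitions and their labellings\<close>

lemma cell_eqI:
  assumes "partition_on UNIV P" "A \<in> P" "x \<in> A"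
  shows "cell P x = A"
  unfolding cell_def using assms by (intro the_equality) (auto simp: partition_on_def disjoint_def)

lemma cell_mem:
  assumes "partition_on UNIV P"
  shows "cell P x \<in> P" "x \<in> cell P x"
proof -
  obtain A where "A \<in> P" "x \<in> A"
    using partition_onD1[OF assms] by blast
  then show "cell P x \<in> P" "x \<in> cell P x"
    using cell_eqI[OF assms] by auto
qed

lemma cell_eq_iff:
  assumes "partition_on UNIV P"
  shows "cell P y = cell P x \<longleftrightarrow> y \<in> cell P x"
  using cell_mem[OF assms] cell_eqI[OF assms] by metis

lemma cell_pull_partition:
  assumes "partition_on UNIV P"
  shows "partition_on UNIV (pull_partition g P)" "cell (pull_partition g P) x = g -` cell P (g x)"
proof -
  have P: "\<Union>P = UNIV" "disjoint P"
    using assms by (auto simp: partition_on_def)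
  show *: "partition_on UNIV (pull_partition g P)"
  proof (rule partition_onI)
    show "\<Union>(pull_partition g P) = UNIV"
    proof (intro equalityI subsetI)
      fix x
      show "x \<in> \<Union>(pull_partition g P)"
        using cell_mem[OF assms, of "g x"]
        by (intro UnionI[of "g -` cell P (g x)"]) (auto simp: pull_partition_def)
    qed simp
    fix p q assume pq: "p \<in> pull_partition g P" "q \<in> pull_partition g P" "p \<noteq> q"
    then obtain A B where AB: "A \<in> P" "B \<in> P" "p = g -` A" "q = g -` B"
      by (auto simp: pull_partition_def)
    with pq(3) P(2) have "A \<inter> B = {}"
      by (auto simp: disjoint_def)
    with AB show "disjnt p q"
      by (auto simp: disjnt_def)
  qed (auto simp: pull_partition_def)
  show "cell (pull_partition g P) x = g -` cell P (g x)"
    using cell_mem[OF assms, of "g x"] by (intro cell_eqI[OF *]) (auto simp: pull_partition_def)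
qed

text \<open>A nonempty intersection of parts, one from each partition, is determined by any of its
  points: the chosen parts are the cells of that point.\<close>

lemma common_refinement_cells:
  assumes "\<And>Q. Q \<in> \<Q> \<Longrightarrow> partition_on UNIV Q"
  shows "common_refinement \<Q> = range (\<lambda>x. \<Inter>Q\<in>\<Q>. cell Q x)"
proof (intro equalityI subsetI)
  fix A assume "A \<in> common_refinement \<Q>"
  then obtain F x where F: "F \<in> (\<Pi> Q\<in>\<Q>. Q)" "A = \<Inter>(F ` \<Q>)" "x \<in> A"
    by (auto simp: common_refinement)
  then have "cell Q x = F Q" if "Q \<in> \<Q>" for Q
    using that assms by (intro cell_eqI) auto
  then have "A = (\<Inter>Q\<in>\<Q>. cell Q x)"
    using F(2) by auto
  then show "A \<in> range (\<lambda>x. \<Inter>Q\<in>\<Q>. cell Q x)"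
    by blast
next
  fix A assume "A \<in> range (\<lambda>x. \<Inter>Q\<in>\<Q>. cell Q x)"
  then obtain x where "A = (\<Inter>Q\<in>\<Q>. cell Q x)"
    by blast
  moreover from this have "A \<noteq> {}"
    using cell_mem(2)[OF assms, of _ x] by blast
  ultimately show "A \<in> common_refinement \<Q>"
    using cell_mem[OF assms, of _ x]
    by (auto simp: common_refinement intro!: bexI[of _ "\<lambda>Q. cell Q x"])
qed

text \<open>Two points share a part of the join exactly when their orbits visit the same cells of
  \<open>P\<close> at all times below \<open>n\<close>.\<close>

lemma iterated_partition_eq_fibres:
  assumes "partition_on UNIV P"
  shows "iterated_partition f P n = fibres (itinerary f (cell P) n)"
proof -
  have "(\<Inter>k<n. cell (pull_partition (f ^^ k) P) x)
      = itinerary f (cell P) n -` {itinerary f (cell P) n x}" for x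
    by (auto simp: cell_pull_partition[OF assms] cell_eq_iff[OF assms] itinerary_def)
  then show ?thesis
    unfolding iterated_partition_def fibres_def
    by (subst common_refinement_cells) (auto simp: cell_pull_partition[OF assms])
qed

lemma entropy_wrt_eq_entropy_rate:
  assumes "partition_on UNIV P"
  shows "entropy_wrt f \<mu> P = entropy_rate f \<mu> (cell P)"
  by (simp add: entropy_wrt_def entropy_rate_def iterated_partition_eq_fibres[OF assms]
      partition_entropy_fibres)

lemma simple_function_cell:
  assumes "space \<mu> = UNIV" "P \<in> finite_partitions \<mu>"
  shows "partition_on UNIV P" "simple_function \<mu> (cell P)"
proof -
  show *: "partition_on UNIV P"
    using assms by (simp add: finite_partitions_def)
  have "range (cell P) \<subseteq> P"
    using cell_mem[OF *] by auto
  moreover have "cell P -` {cell P x} = cell P x" for x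
    using cell_eq_iff[OF *] by auto
  ultimately show "simple_function \<mu> (cell P)"
    using assms cell_mem(1)[OF *]
    by (auto simp: simple_function_def finite_partitions_def intro: finite_subset)
qed

lemma fibres_finite_partition:
  assumes "space \<mu> = UNIV" "simple_function \<mu> g"
  shows "fibres g \<in> finite_partitions \<mu>" "cell (fibres g) x = g -` {g x}"
proof -
  have p: "partition_on UNIV (fibres g)"
    by (rule partition_onI) (auto simp: fibres_def disjnt_def)
  have "fibres g = (\<lambda>y. g -` {y}) ` range g"
    by (auto simp: fibres_def)
  with p assms show "fibres g \<in> finite_partitions \<mu>"
    by (auto simp: finite_partitions_def simple_function_def)
  show "cell (fibres g) x = g -` {g x}"
    by (rule cell_eqI[OF p]) (auto simp: fibres_def)
qed

lemma entropy_rate_le_measure_entropy: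
  assumes \<mu>: "\<mu> \<in> inv_measures f" and f: "f \<in> borel_measurable borel" and g: "simple_function \<mu> g"
  shows "ereal (entropy_rate f \<mu> g) \<le> measure_entropy f \<mu>"
proof -
  note D = inv_measuresD[OF \<mu>]
  note F = fibres_finite_partition[OF D(2) g]
  note C = simple_function_cell[OF D(2) F(1)]
  \<comment> \<open>Since \<open>g\<close> is constant on each of its fibres, evaluating it at a
    chosen point of the cell recovers it; so \<open>g\<close> is a coarsening of
    \<open>cell (fibres g)\<close>.\<close>
  have "g = (\<lambda>A. g (SOME y. y \<in> A)) \<circ> cell (fibres g)"
  proof
    fix x
    have "(SOME y. y \<in> g -` {g x}) \<in> g -` {g x}"
      by (rule someI[of _ x]) simp
    then show "g x = ((\<lambda>A. g (SOME y. y \<in> A)) \<circ> cell (fibres g)) x"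
      by (simp add: F(2))
  qed
  then have "entropy_rate f \<mu> g \<le> entropy_rate f \<mu> (cell (fibres g))"
    using entropy_rate_comp_le[OF \<mu> f C(2)] by metis
  then have "ereal (entropy_rate f \<mu> g) \<le> ereal (entropy_wrt f \<mu> (fibres g))"
    by (simp add: entropy_wrt_eq_entropy_rate[OF C(1)])
  also have "\<dots> \<le> measure_entropy f \<mu>"
    unfolding measure_entropy_def by (rule SUP_upper[OF F(1)])
  finally show ?thesis .
qed

text \<open>The constant labelling already has a nonnegative rate.\<close>

lemma measure_entropy_nonneg:
  assumes "\<mu> \<in> inv_measures f" "f \<in> borel_measurable borel"
  shows "0 \<le> measure_entropy f \<mu>"
proof -
  have "0 \<le> ereal (entropy_rate f \<mu> (\<lambda>_. ()))"
    using entropy_rate_nonneg[OF assms, of "\<lambda>_. ()"] by simp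
  also have "\<dots> \<le> measure_entropy f \<mu>"
    by (rule entropy_rate_le_measure_entropy[OF assms]) simp
  finally show ?thesis .
qed

lemma less_measure_entropyE:
  assumes "\<mu> \<in> inv_measures f" "ereal a < measure_entropy f \<mu>"
  obtains P where "P \<in> finite_partitions \<mu>" "a < entropy_rate f \<mu> (cell P)"
proof -
  obtain P where P: "P \<in> finite_partitions \<mu>" "ereal a < ereal (entropy_wrt f \<mu> P)"
    using assms(2) unfolding measure_entropy_def less_SUP_iff by blast
  then have "partition_on UNIV P"
    using simple_function_cell inv_measuresD[OF assms(1)] by blast
  with P that show ?thesis
    by (simp add: entropy_wrt_eq_entropy_rate)
qed

section \<open>Mixtures of measures\<close>

text \<open>The convex combination with weights \<open>t\<close> and \<open>1 - t\<close>, realized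
  by a coin toss that selects the measure to sample from; as a monadic bind it inherits its
  integration formula from the library.\<close>

definition mixture :: "real \<Rightarrow> 'a measure \<Rightarrow> 'a measure \<Rightarrow> 'a measure" where
  "mixture t \<mu> \<nu> = measure_pmf (bernoulli_pmf t) \<bind> (\<lambda>b. if b then \<mu> else \<nu>)"

lemma
  assumes t: "0 \<le> t" "t \<le> 1"
    and \<mu>: "prob_space \<mu>" "sets \<mu> = sets M" and \<nu>: "prob_space \<nu>" "sets \<nu> = sets M"
  shows sets_mixture: "sets (mixture t \<mu> \<nu>) = sets M"
    and prob_space_mixture: "prob_space (mixture t \<mu> \<nu>)"
    and nn_integral_mixture: "\<And>g. g \<in> borel_measurable M \<Longrightarrow>
      (\<integral>\<^sup>+x. g x \<partial>mixture t \<mu> \<nu>) = (\<integral>\<^sup>+x. g x \<partial>\<mu>) * t + (\<integral>\<^sup>+x. g x \<partial>\<nu>) * (1 - t)"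
    and measure_mixture: "\<And>A. A \<in> sets M \<Longrightarrow>
      measure (mixture t \<mu> \<nu>) A = t * measure \<mu> A + (1 - t) * measure \<nu> A"
    and integral_mixture: "\<And>(g :: _ \<Rightarrow> real) B. g \<in> borel_measurable M \<Longrightarrow> (\<And>x. \<bar>g x\<bar> \<le> B) \<Longrightarrow>
      (\<integral>x. g x \<partial>mixture t \<mu> \<nu>) = t * (\<integral>x. g x \<partial>\<mu>) + (1 - t) * (\<integral>x. g x \<partial>\<nu>)"
proof -
  interpret \<mu>: prob_space \<mu> by fact
  interpret \<nu>: prob_space \<nu> by fact
  note [measurable_cong] = \<mu>(2) \<nu>(2)
  have kernel: "(\<lambda>b. if b then \<mu> else \<nu>) \<in> measurable (measure_pmf (bernoulli_pmf t)) (subprob_algebra M)"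
    using \<mu>.subprob_space_axioms \<nu>.subprob_space_axioms \<mu>(2) \<nu>(2)
    by (auto simp: space_subprob_algebra)
  show sets: "sets (mixture t \<mu> \<nu>) = sets M"
    unfolding mixture_def by (rule sets_bind_measurable[OF kernel]) simp
  show prob: "prob_space (mixture t \<mu> \<nu>)"
    unfolding mixture_def
    by (rule measure_pmf.prob_space_bind[OF _ kernel]) (auto simp: \<mu>(1) \<nu>(1))
  interpret m: prob_space "mixture t \<mu> \<nu>" by fact
  show nn: "(\<integral>\<^sup>+x. g x \<partial>mixture t \<mu> \<nu>) = (\<integral>\<^sup>+x. g x \<partial>\<mu>) * t + (\<integral>\<^sup>+x. g x \<partial>\<nu>) * (1 - t)"
    if "g \<in> borel_measurable M" for g
    unfolding mixture_def using t by (subst nn_integral_bind[OF that kernel]) simp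
  show "measure (mixture t \<mu> \<nu>) A = t * measure \<mu> A + (1 - t) * measure \<nu> A" if A: "A \<in> sets M" for A
  proof -
    have "emeasure (mixture t \<mu> \<nu>) A = emeasure \<mu> A * t + emeasure \<nu> A * (1 - t)"
      using nn[of "indicator A"] A \<mu>(2) \<nu>(2) sets by simp
    also have "\<dots> = ennreal (t * measure \<mu> A + (1 - t) * measure \<nu> A)"
      using t by (simp add: \<mu>.emeasure_eq_measure \<nu>.emeasure_eq_measure mult.commute
          flip: ennreal_mult' ennreal_plus)
    finally show ?thesis
      using t by (intro measure_eq_emeasure_eq_ennreal) auto
  qed
  show "(\<integral>x. g x \<partial>mixture t \<mu> \<nu>) = t * (\<integral>x. g x \<partial>\<mu>) + (1 - t) * (\<integral>x. g x \<partial>\<nu>)"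
    if g: "g \<in> borel_measurable M" and B: "\<And>x. \<bar>g x\<bar> \<le> B" for g :: "_ \<Rightarrow> real" and B
  proof -
    \<comment> \<open>Adding \<open>B\<close> makes the integrand nonnegative, so the formula for
      nonnegative integrals applies; since the weights sum to 1, the shift cancels at the
      end.\<close>
    have pos: "0 \<le> g x + B" for x
      using B[of x] by linarith
    have shift: "(\<integral>\<^sup>+x. ennreal (g x + B) \<partial>N) = ennreal ((\<integral>x. g x \<partial>N) + B)"
      and ge: "0 \<le> (\<integral>x. g x \<partial>N) + B"
      if N: "prob_space N" "sets N = sets M" for N
    proof -
      interpret N: prob_space N by fact
      have int: "integrable N g"
        using g B N(2) by (intro N.integrable_const_bound[of _ B]) (auto cong: measurable_cong_sets)
      then have eq: "(\<integral>x. g x + B \<partial>N) = (\<integral>x. g x \<partial>N) + B"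
        by (simp add: N.prob_space)
      then show "(\<integral>\<^sup>+x. ennreal (g x + B) \<partial>N) = ennreal ((\<integral>x. g x \<partial>N) + B)"
        using int pos by (subst nn_integral_eq_integral) auto
      have "0 \<le> (\<integral>x. g x + B \<partial>N)"
        using pos by simp
      then show "0 \<le> (\<integral>x. g x \<partial>N) + B"
        by (simp add: eq)
    qed
    have "ennreal ((\<integral>x. g x \<partial>mixture t \<mu> \<nu>) + B)
        = ennreal ((\<integral>x. g x \<partial>\<mu>) + B) * t + ennreal ((\<integral>x. g x \<partial>\<nu>) + B) * (1 - t)"
      using nn[of "\<lambda>x. ennreal (g x + B)"] g
      by (simp add: shift \<mu> \<nu> prob sets)
    also have "\<dots> = ennreal (((\<integral>x. g x \<partial>\<mu>) + B) * t + ((\<integral>x. g x \<partial>\<nu>) + B) * (1 - t))"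
      using t ge[OF \<mu>] ge[OF \<nu>] by (simp flip: ennreal_mult' ennreal_plus)
    finally have "(\<integral>x. g x \<partial>mixture t \<mu> \<nu>) + B
        = ((\<integral>x. g x \<partial>\<mu>) + B) * t + ((\<integral>x. g x \<partial>\<nu>) + B) * (1 - t)"
      using ge[OF \<mu>] ge[OF \<nu>] ge[OF prob sets] t by (subst (asm) ennreal_inj) auto
    then show ?thesis
      by (simp add: algebra_simps)
  qed
qed

text \<open>Invariance equates the measures of a Borel set and of its preimage, a condition that is
  linear in the measure.\<close>

lemma mixture_invariant:
  assumes t: "0 \<le> t" "t \<le> 1" and \<mu>: "\<mu> \<in> inv_measures f" and \<nu>: "\<nu> \<in> inv_measures f"
    and f: "f \<in> borel_measurable borel"
  shows "mixture t \<mu> \<nu> \<in> inv_measures f"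
proof -
  note D = inv_measuresD[OF \<mu>] and E = inv_measuresD[OF \<nu>]
  note mix = t D(1,3) E(1,3)
  note sets = sets_mixture[OF mix] and prob = prob_space_mixture[OF mix]
  interpret m: prob_space "mixture t \<mu> \<nu>" by (rule prob)
  have inv: "measure N (f -` A) = measure N A" if "N \<in> inv_measures f" "A \<in> sets borel" for N A
  proof -
    note N = inv_measuresD[OF that(1)]
    have "f \<in> measurable N borel"
      using f N(3) measurable_cong_sets[of N borel borel borel] by auto
    then have "measure (distr N borel f) A = measure N (f -` A)"
      using N(2) that by (subst measure_distr) auto
    then show ?thesis by (simp add: N(4))
  qed
  have f': "f \<in> measurable (mixture t \<mu> \<nu>) borel"
    using f sets measurable_cong_sets[of "mixture t \<mu> \<nu>" borel borel borel] by auto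
  interpret d: prob_space "distr (mixture t \<mu> \<nu>) borel f"
    by (rule m.prob_space_distr[OF f'])
  have "distr (mixture t \<mu> \<nu>) borel f = mixture t \<mu> \<nu>"
  proof (rule measure_eqI)
    fix A assume "A \<in> sets (distr (mixture t \<mu> \<nu>) borel f)"
    then have A: "A \<in> sets borel" by simp
    moreover have "f -` A \<in> sets borel"
      using measurable_sets[OF f A] by simp
    moreover have "space (mixture t \<mu> \<nu>) = UNIV"
      using sets_eq_imp_space_eq[OF sets] by simp
    ultimately have "measure (distr (mixture t \<mu> \<nu>) borel f) A = measure (mixture t \<mu> \<nu>) A"
      by (simp add: measure_distr[OF f'] measure_mixture[OF mix] inv[OF \<mu>] inv[OF \<nu>])
    then show "emeasure (distr (mixture t \<mu> \<nu>) borel f) A = emeasure (mixture t \<mu> \<nu>) A"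
      by (simp add: d.emeasure_eq_measure m.emeasure_eq_measure)
  qed (simp add: sets)
  with sets prob show ?thesis
    by (simp add: inv_measures_def)
qed

section \<open>Concavity of the entropy\<close>

text \<open>With \<open>z\<close> the weighted mean, \<open>ln (z / u) \<le> z / u - 1\<close>
  bounds \<open>u * ln z\<close> by \<open>u * ln u\<close> up to the linear error
  \<open>z - u\<close>. The errors at \<open>x\<close> and \<open>y\<close> cancel in the weighted
  sum.\<close>

lemma xlnx_convex:
  fixes x y t :: real
  assumes t: "0 \<le> t" "t \<le> 1" and xy: "0 \<le> x" "0 \<le> y"
  shows "(t * x + (1 - t) * y) * ln (t * x + (1 - t) * y) \<le> t * (x * ln x) + (1 - t) * (y * ln y)"
proof (cases "t = 0 \<or> t = 1")
  case False
  with t have t': "0 < t" "t < 1" by auto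
  define z where "z = t * x + (1 - t) * y"
  have aux: "u * ln z \<le> u * ln u + (z - u)" if "0 \<le> u" "0 < u \<Longrightarrow> 0 < z" "0 \<le> z" for u
  proof (cases "u = 0")
    case False
    with that have u: "0 < u" "0 < z" by auto
    then have "ln (z / u) \<le> z / u - 1"
      by (intro ln_le_minus_one) simp
    then have "u * (ln z - ln u) \<le> u * (z / u - 1)"
      using u by (intro mult_left_mono) (auto simp: ln_div)
    then show ?thesis
      using u by (simp add: algebra_simps)
  qed (use that in simp)
  have "0 \<le> z" "0 < x \<Longrightarrow> 0 < z" "0 < y \<Longrightarrow> 0 < z"
    using t' xy by (auto simp: z_def intro: add_pos_nonneg add_nonneg_pos)
  then have "x * ln z \<le> x * ln x + (z - x)" "y * ln z \<le> y * ln y + (z - y)"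
    using xy by (auto intro: aux)
  then have "t * (x * ln z) + (1 - t) * (y * ln z)
      \<le> t * (x * ln x + (z - x)) + (1 - t) * (y * ln y + (z - y))"
    using t by (intro add_mono mult_left_mono) auto
  also have "\<dots> = t * (x * ln x) + (1 - t) * (y * ln y) + (z - (t * x + (1 - t) * y))"
    by (simp add: algebra_simps)
  finally show ?thesis
    unfolding z_def[symmetric] by (simp add: z_def algebra_simps)
qed auto

lemma label_entropy_concave:
  assumes t: "0 \<le> t" "t \<le> 1" and \<mu>: "\<mu> \<in> inv_measures f" and \<nu>: "\<nu> \<in> inv_measures f"
    and g: "simple_function borel g"
  shows "t * label_entropy \<mu> g + (1 - t) * label_entropy \<nu> g \<le> label_entropy (mixture t \<mu> \<nu>) g"
proof -
  note D = inv_measuresD[OF \<mu>] and E = inv_measuresD[OF \<nu>]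
  have "g -` {y} \<in> sets borel" for y
    using simple_functionD(2)[OF g, of "{y}"] by simp
  then have "measure (mixture t \<mu> \<nu>) (g -` {y}) * ln (measure (mixture t \<mu> \<nu>) (g -` {y}))
      \<le> t * (measure \<mu> (g -` {y}) * ln (measure \<mu> (g -` {y})))
        + (1 - t) * (measure \<nu> (g -` {y}) * ln (measure \<nu> (g -` {y})))" for y
    using xlnx_convex[OF t] by (simp add: measure_mixture[OF t D(1,3) E(1,3)])
  then have "(\<Sum>y\<in>range g. measure (mixture t \<mu> \<nu>) (g -` {y}) * ln (measure (mixture t \<mu> \<nu>) (g -` {y})))
      \<le> (\<Sum>y\<in>range g. t * (measure \<mu> (g -` {y}) * ln (measure \<mu> (g -` {y})))
        + (1 - t) * (measure \<nu> (g -` {y}) * ln (measure \<nu> (g -` {y}))))"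
    by (rule sum_mono)
  then show ?thesis
    by (simp add: label_entropy_def sum.distrib sum_distrib_left)
qed

text \<open>Lets one labelling serve all invariant measures at once, as they share the Borel
  sets.\<close>

lemma simple_function_cong_borel:
  assumes "\<mu> \<in> inv_measures f"
  shows "simple_function \<mu> g \<longleftrightarrow> simple_function borel g"
  using inv_measuresD[OF assms] by (simp add: simple_function_def)

text \<open>Concavity at each itinerary length passes to the limit. Real lower bounds
  \<open>a\<close> and \<open>b\<close> stand in for the entropies, so infinite values need no
  arithmetic.\<close>

lemma measure_entropy_concave:
  assumes t: "0 \<le> t" "t \<le> 1" and \<mu>: "\<mu> \<in> inv_measures f" and \<nu>: "\<nu> \<in> inv_measures f"
    and f: "f \<in> borel_measurable borel"
    and a: "ereal a \<le> measure_entropy f \<mu>" and b: "ereal b \<le> measure_entropy f \<nu>"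
  shows "ereal (t * a + (1 - t) * b) \<le> measure_entropy f (mixture t \<mu> \<nu>)"
proof -
  have mix: "mixture t \<mu> \<nu> \<in> inv_measures f"
    by (rule mixture_invariant[OF t \<mu> \<nu> f])
  have approx: "ereal (t * a + (1 - t) * b - e) \<le> measure_entropy f (mixture t \<mu> \<nu>)" if "0 < e" for e
  proof -
    have "ereal (a - e) < measure_entropy f \<mu>" "ereal (b - e) < measure_entropy f \<nu>"
      using a b \<open>0 < e\<close> by (auto intro: less_le_trans[rotated])
    then obtain P Q where P: "P \<in> finite_partitions \<mu>" "a - e < entropy_rate f \<mu> (cell P)"
      and Q: "Q \<in> finite_partitions \<nu>" "b - e < entropy_rate f \<nu> (cell Q)"
      using less_measure_entropyE[OF \<mu>] less_measure_entropyE[OF \<nu>] by metis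
    \<comment> \<open>Partitions nearly optimal for the two measures may differ; their join refines
      both and is therefore nearly optimal for both.\<close>
    define g where "g = (\<lambda>x. (cell P x, cell Q x))"
    have "simple_function borel (cell P)" "simple_function borel (cell Q)"
      using simple_function_cell P Q inv_measuresD \<mu> \<nu> simple_function_cong_borel by metis+
    then have g: "simple_function borel g"
      unfolding g_def by (rule simple_function_Pair)
    have it: "simple_function borel (itinerary f g n)" for n
      by (rule simple_function_itinerary[OF f g])
    have g\<mu>: "simple_function \<mu> g" and g\<nu>: "simple_function \<nu> g"
      and gm: "simple_function (mixture t \<mu> \<nu>) g"
      using g \<mu> \<nu> mix simple_function_cong_borel by blast+
    have "cell P = fst \<circ> g" "cell Q = snd \<circ> g"
      by (auto simp: g_def)
    then have "a - e \<le> entropy_rate f \<mu> g" "b - e \<le> entropy_rate f \<nu> g"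
      using P(2) Q(2) entropy_rate_comp_le[OF \<mu> f g\<mu>, of fst] entropy_rate_comp_le[OF \<nu> f g\<nu>, of snd]
      by auto
    then have "t * (a - e) + (1 - t) * (b - e)
        \<le> t * entropy_rate f \<mu> g + (1 - t) * entropy_rate f \<nu> g"
      using t by (intro add_mono mult_left_mono) auto
    also have "\<dots> \<le> entropy_rate f (mixture t \<mu> \<nu>) g"
    proof (rule LIMSEQ_le)
      show "(\<lambda>n. t * (label_entropy \<mu> (itinerary f g n) / real n)
          + (1 - t) * (label_entropy \<nu> (itinerary f g n) / real n))
        \<longlonglongrightarrow> t * entropy_rate f \<mu> g + (1 - t) * entropy_rate f \<nu> g"
        by (intro tendsto_intros entropy_rate_LIMSEQ \<mu> \<nu> f g\<mu> g\<nu>)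
      show "(\<lambda>n. label_entropy (mixture t \<mu> \<nu>) (itinerary f g n) / real n)
        \<longlonglongrightarrow> entropy_rate f (mixture t \<mu> \<nu>) g"
        by (rule entropy_rate_LIMSEQ[OF mix f gm])
      have "t * (label_entropy \<mu> (itinerary f g n) / real n)
          + (1 - t) * (label_entropy \<nu> (itinerary f g n) / real n)
        \<le> label_entropy (mixture t \<mu> \<nu>) (itinerary f g n) / real n" for n
        using divide_right_mono[OF label_entropy_concave[OF t \<mu> \<nu> it], of "real n" n]
        by (simp add: add_divide_distrib)
      then show "\<exists>N. \<forall>n\<ge>N. t * (label_entropy \<mu> (itinerary f g n) / real n)
          + (1 - t) * (label_entropy \<nu> (itinerary f g n) / real n)
        \<le> label_entropy (mixture t \<mu> \<nu>) (itinerary f g n) / real n"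
        by blast
    qed
    finally have "ereal (t * a + (1 - t) * b - e) \<le> ereal (entropy_rate f (mixture t \<mu> \<nu>) g)"
      by (simp add: algebra_simps)
    also have "\<dots> \<le> measure_entropy f (mixture t \<mu> \<nu>)"
      by (rule entropy_rate_le_measure_entropy[OF mix f gm])
    finally show ?thesis .
  qed
  show ?thesis
  proof (rule ereal_le_epsilon2)
    fix e :: real assume "0 < e"
    have "ereal (t * a + (1 - t) * b) = ereal (t * a + (1 - t) * b - e) + ereal e"
      by simp
    also have "\<dots> \<le> measure_entropy f (mixture t \<mu> \<nu>) + ereal e"
      by (rule add_right_mono[OF approx[OF \<open>0 < e\<close>]])
    finally show "ereal (t * a + (1 - t) * b) \<le> measure_entropy f (mixture t \<mu> \<nu>) + ereal e" .
  qed
qed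

section \<open>Rotation vectors\<close>

text \<open>As a Bochner integral, the rotation vector obeys the norm inequality for integrals
  directly, without a factor depending on the dimension.\<close>

lemma rv_eq_integral:
  assumes "compact (UNIV :: 'a::metric_space set)" "continuous_on UNIV (\<Psi> :: 'a \<Rightarrow> real ^ 'm)"
    and "\<mu> \<in> inv_measures f"
  shows "integrable \<mu> \<Psi>" "rv \<Psi> \<mu> = (\<integral>x. \<Psi> x \<partial>\<mu>)"
proof -
  note D = inv_measuresD[OF assms(3)]
  interpret prob_space \<mu> by (rule D)
  obtain B where B: "\<And>x. norm (\<Psi> x) \<le> B"
    using compact_imp_bounded[OF compact_continuous_image[OF assms(2,1)]] by (auto simp: bounded_iff)
  have "\<Psi> \<in> borel_measurable \<mu>"
    using borel_measurable_continuous_onI[OF assms(2)] D(3) measurable_cong_sets[of \<mu> borel borel borel]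
    by auto
  then show int: "integrable \<mu> \<Psi>"
    by (intro integrable_const_bound[of _ B]) (auto simp: B)
  show "rv \<Psi> \<mu> = (\<integral>x. \<Psi> x \<partial>\<mu>)"
    using integral_bounded_linear[OF bounded_linear_vec_nth int]
    by (simp add: rv_def vec_eq_iff)
qed

lemma rv_dist_le:
  fixes \<Psi> \<Phi> :: "'a::metric_space \<Rightarrow> real ^ 'm"
  assumes "compact (UNIV :: 'a set)" "continuous_on UNIV \<Psi>" "continuous_on UNIV \<Phi>"
    and "\<mu> \<in> inv_measures f" and e: "\<And>x. norm (\<Psi> x - \<Phi> x) \<le> e"
  shows "norm (rv \<Psi> \<mu> - rv \<Phi> \<mu>) \<le> e"
proof -
  interpret prob_space \<mu> by (rule inv_measuresD[OF assms(4)])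
  note \<Psi> = rv_eq_integral[OF assms(1,2,4)] and \<Phi> = rv_eq_integral[OF assms(1,3,4)]
  have "rv \<Psi> \<mu> - rv \<Phi> \<mu> = (\<integral>x. \<Psi> x - \<Phi> x \<partial>\<mu>)"
    using \<Psi> \<Phi> by simp
  also have "norm \<dots> \<le> (\<integral>x. norm (\<Psi> x - \<Phi> x) \<partial>\<mu>)"
    by (rule integral_norm_bound)
  also have "\<dots> \<le> (\<integral>x. e \<partial>\<mu>)"
    using \<Psi>(1) \<Phi>(1) e by (intro integral_mono) auto
  also have "\<dots> = e"
    by (simp add: prob_space)
  finally show ?thesis .
qed

lemma rv_mixture:
  fixes \<Psi> :: "'a::metric_space \<Rightarrow> real ^ 'm"
  assumes "compact (UNIV :: 'a set)" "continuous_on UNIV \<Psi>"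
    and t: "0 \<le> t" "t \<le> 1" and \<mu>: "\<mu> \<in> inv_measures f" and \<nu>: "\<nu> \<in> inv_measures f"
  shows "rv \<Psi> (mixture t \<mu> \<nu>) = t *\<^sub>R rv \<Psi> \<mu> + (1 - t) *\<^sub>R rv \<Psi> \<nu>"
proof -
  note D = inv_measuresD[OF \<mu>] and E = inv_measuresD[OF \<nu>]
  obtain B where B: "\<And>x. norm (\<Psi> x) \<le> B"
    using compact_imp_bounded[OF compact_continuous_image[OF assms(2,1)]] by (auto simp: bounded_iff)
  have "(\<lambda>x. \<Psi> x $ i) \<in> borel_measurable borel" for i
    by (intro borel_measurable_continuous_onI continuous_intros assms)
  moreover have "\<bar>\<Psi> x $ i\<bar> \<le> B" for x i
    using component_le_norm_cart[of "\<Psi> x" i] B[of x] by linarith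
  ultimately have "(\<integral>x. \<Psi> x $ i \<partial>mixture t \<mu> \<nu>)
      = t * (\<integral>x. \<Psi> x $ i \<partial>\<mu>) + (1 - t) * (\<integral>x. \<Psi> x $ i \<partial>\<nu>)" for i
    by (rule integral_mixture[OF t D(1,3) E(1,3)])
  then show ?thesis
    by (simp add: rv_def vec_eq_iff)
qed

lemma convex_rv_entropy_ge:
  fixes f :: "'a::metric_space \<Rightarrow> 'a" and \<Psi> :: "'a \<Rightarrow> real ^ 'm"
  assumes "compact (UNIV :: 'a set)" "continuous_on UNIV \<Psi>" and f: "f \<in> borel_measurable borel"
  shows "convex (rv \<Psi> ` {\<mu> \<in> inv_measures f. ereal c \<le> measure_entropy f \<mu>})"
proof (rule convexI)
  fix x y :: "real ^ 'm" and u v :: real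
  assume "x \<in> rv \<Psi> ` {\<mu> \<in> inv_measures f. ereal c \<le> measure_entropy f \<mu>}"
    and "y \<in> rv \<Psi> ` {\<mu> \<in> inv_measures f. ereal c \<le> measure_entropy f \<mu>}"
    and uv: "0 \<le> u" "0 \<le> v" "u + v = 1"
  then obtain \<mu> \<nu> where m: "x = rv \<Psi> \<mu>" "\<mu> \<in> inv_measures f" "ereal c \<le> measure_entropy f \<mu>"
    and n: "y = rv \<Psi> \<nu>" "\<nu> \<in> inv_measures f" "ereal c \<le> measure_entropy f \<nu>"
    by blast
  have u: "u \<le> 1" "v = 1 - u" using uv by auto
  have "u *\<^sub>R x + v *\<^sub>R y = rv \<Psi> (mixture u \<mu> \<nu>)"
    using rv_mixture[OF assms(1,2) uv(1) u(1) m(2) n(2)] m n u by simp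
  moreover have "mixture u \<mu> \<nu> \<in> inv_measures f"
    by (rule mixture_invariant[OF uv(1) u(1) m(2) n(2) f])
  moreover have "ereal c \<le> measure_entropy f (mixture u \<mu> \<nu>)"
    using measure_entropy_concave[OF uv(1) u(1) m(2) n(2) f m(3) n(3)] by (simp add: algebra_simps)
  ultimately show "u *\<^sub>R x + v *\<^sub>R y \<in> rv \<Psi> ` {\<mu> \<in> inv_measures f. ereal c \<le> measure_entropy f \<mu>}"
    by blast
qed

text \<open>The level 0 imposes no restriction, so results on entropy levels also apply to the
  rotation set itself.\<close>

lemma Rot_eq_entropy_nonneg:
  assumes "f \<in> borel_measurable borel"
  shows "Rot f \<Psi> = rv \<Psi> ` {\<mu> \<in> inv_measures f. ereal 0 \<le> measure_entropy f \<mu>}"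
  using measure_entropy_nonneg[OF _ assms] by (auto simp: Rot_def simp flip: zero_ereal_def)

lemma loc_entropy_geI:
  assumes "w \<in> rv \<Psi> ` {\<mu> \<in> inv_measures f. c \<le> measure_entropy f \<mu>}"
  shows "c \<le> loc_entropy f \<Psi> w"
  using assms unfolding loc_entropy_def by (auto intro: SUP_upper2)

text \<open>If \<open>w\<close> were outside, a hyperplane would separate it from \<open>S\<close>.
  In the direction \<open>u\<close> of its normal, \<open>S\<close> has a point reaching at least
  \<open>R - d\<close> beyond \<open>w0\<close>, while \<open>w\<close> reaches less. The strict
  bound on \<open>w\<close> makes weak separation enough.\<close>

lemma convex_contains_ball_if_near_sphere:
  fixes S :: "'b::euclidean_space set"
  assumes "convex S"
    and near: "\<And>u. norm u = 1 \<Longrightarrow> \<exists>x\<in>S. norm (x - (w0 + R *\<^sub>R u)) \<le> d"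
    and w: "norm (w - w0) < R - d"
  shows "w \<in> S"
proof (rule ccontr)
  assume "w \<notin> S"
  \<comment> \<open>Separation needs \<open>S\<close> to be nonempty; any unit vector provides a
    point of it.\<close>
  obtain b :: 'b where "norm b = 1"
    using vector_choose_size[of 1] by auto
  with near have "S \<noteq> {}" by blast
  with \<open>w \<notin> S\<close> obtain a \<beta> where a: "a \<noteq> 0" "\<forall>x\<in>S. a \<bullet> x \<le> \<beta>" "\<beta> \<le> a \<bullet> w"
    using separating_hyperplane_sets[OF \<open>convex S\<close>, of "{w}"] by auto
  define u where "u = a /\<^sub>R norm a"
  have u: "norm u = 1"
    using a(1) by (simp add: u_def)
  obtain x where x: "x \<in> S" "norm (x - (w0 + R *\<^sub>R u)) \<le> d"
    using near[OF u] by blast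
  have "a \<bullet> x \<le> a \<bullet> w"
    using a(2,3) x(1) by force
  then have "u \<bullet> x \<le> u \<bullet> w"
    by (simp add: u_def divide_right_mono inverse_eq_divide)
  then have "u \<bullet> (R *\<^sub>R u) \<le> u \<bullet> (w - w0) + u \<bullet> ((w0 + R *\<^sub>R u) - x)"
    by (simp add: inner_diff_right inner_add_right)
  also have "u \<bullet> (w - w0) \<le> norm (w - w0)"
    using norm_cauchy_schwarz[of u "w - w0"] u by simp
  also have "u \<bullet> ((w0 + R *\<^sub>R u) - x) \<le> d"
    using norm_cauchy_schwarz[of u "(w0 + R *\<^sub>R u) - x"] u x(2) by (simp add: norm_minus_commute)
  finally have "R * (u \<bullet> u) \<le> norm (w - w0) + d" by simp
  with w u show False
    by (simp flip: power2_norm_eq_inner)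
qed

section \<open>Localized entropy near an interior point\<close>

text \<open>The measures over the sphere are kept while the potential changes: their rotation
  vectors move by at most \<open>d\<close> and the entropy level stays exactly
  \<open>c\<close>.\<close>

lemma rv_entropy_ge_perturb:
  fixes f :: "'a::metric_space \<Rightarrow> 'a" and \<Psi> \<Phi> :: "'a \<Rightarrow> real ^ 'm"
  assumes "compact (UNIV :: 'a set)" "continuous_on UNIV \<Psi>" "continuous_on UNIV \<Phi>"
    and f: "f \<in> borel_measurable borel" and d: "\<And>x. norm (\<Psi> x - \<Phi> x) \<le> d"
    and sphere: "\<And>u. norm u = 1 \<Longrightarrow>
      w0 + R *\<^sub>R u \<in> rv \<Phi> ` {\<mu> \<in> inv_measures f. ereal c \<le> measure_entropy f \<mu>}"
    and w: "norm (w - w0) < R - d"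
  shows "w \<in> rv \<Psi> ` {\<mu> \<in> inv_measures f. ereal c \<le> measure_entropy f \<mu>}"
proof (rule convex_contains_ball_if_near_sphere[OF convex_rv_entropy_ge[OF assms(1,2) f] _ w])
  fix u :: "real ^ 'm" assume "norm u = 1"
  then obtain \<mu> where \<mu>: "\<mu> \<in> inv_measures f" "ereal c \<le> measure_entropy f \<mu>"
    "w0 + R *\<^sub>R u = rv \<Phi> \<mu>"
    using sphere by blast
  then show "\<exists>x\<in>rv \<Psi> ` {\<mu> \<in> inv_measures f. ereal c \<le> measure_entropy f \<mu>}.
      norm (x - (w0 + R *\<^sub>R u)) \<le> d"
    using rv_dist_le[OF assms(1-3) \<mu>(1) d] by auto
qed

text \<open>A measure at \<open>w0\<close> of entropy above \<open>c\<close> is mixed with a small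
  share of measures over the sphere of radius \<open>\<delta>\<close>. These have nonnegative
  entropy, so a small share costs little.\<close>

lemma loc_entropy_lower_sphere:
  fixes f :: "'a::metric_space \<Rightarrow> 'a" and \<Phi> :: "'a \<Rightarrow> real ^ 'm"
  assumes "compact (UNIV :: 'a set)" "continuous_on UNIV \<Phi>" and f: "f \<in> borel_measurable borel"
    and \<delta>: "0 < \<delta>" "cball w0 \<delta> \<subseteq> Rot f \<Phi>" and c: "ereal c < loc_entropy f \<Phi> w0"
  obtains R where "0 < R" "\<And>u. norm u = 1 \<Longrightarrow>
    w0 + R *\<^sub>R u \<in> rv \<Phi> ` {\<mu> \<in> inv_measures f. ereal c \<le> measure_entropy f \<mu>}"
proof -
  obtain c' where c': "c < c'" "ereal c' < loc_entropy f \<Phi> w0"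
    using ereal_dense2[OF c] by auto
  then obtain \<mu> where \<mu>: "\<mu> \<in> inv_measures f" "rv \<Phi> \<mu> = w0" "ereal c' < measure_entropy f \<mu>"
    unfolding loc_entropy_def less_SUP_iff by blast
  \<comment> \<open>Chosen so that \<open>t * c' \<le> c' - c\<close>; the absolute value keeps the
    denominator positive and \<open>t \<le> 1\<close> for either sign of \<open>c'\<close>.\<close>
  define t where "t = (c' - c) / (c' - c + \<bar>c'\<bar>)"
  have t: "0 < t" "t \<le> 1" "c \<le> (1 - t) * c'"
  proof -
    show "0 < t" "t \<le> 1"
      using c'(1) by (auto simp: t_def divide_simps)
    have "t * c' \<le> t * (c' - c + \<bar>c'\<bar>)"
      using \<open>0 < t\<close> c'(1) by (intro mult_left_mono) auto
    also have "\<dots> = c' - c"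
      using c'(1) by (simp add: t_def)
    finally show "c \<le> (1 - t) * c'"
      by (simp add: algebra_simps)
  qed
  show thesis
  proof
    show "0 < t * \<delta>"
      using t \<delta> by simp
    fix u :: "real ^ 'm" assume "norm u = 1"
    then have "w0 + \<delta> *\<^sub>R u \<in> Rot f \<Phi>"
      using \<delta> by (intro subsetD[OF \<delta>(2)]) (simp add: dist_norm)
    then obtain \<nu> where \<nu>: "\<nu> \<in> inv_measures f" "rv \<Phi> \<nu> = w0 + \<delta> *\<^sub>R u"
      by (auto simp: Rot_def)
    have t': "0 \<le> 1 - t" "1 - t \<le> 1" using t by auto
    have "rv \<Phi> (mixture (1 - t) \<mu> \<nu>) = w0 + (t * \<delta>) *\<^sub>R u"
      using rv_mixture[OF assms(1,2) t' \<mu>(1) \<nu>(1)] \<mu> \<nu> by (simp add: algebra_simps)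
    moreover have "mixture (1 - t) \<mu> \<nu> \<in> inv_measures f"
      by (rule mixture_invariant[OF t' \<mu>(1) \<nu>(1) f])
    moreover have "ereal ((1 - t) * c' + (1 - (1 - t)) * 0) \<le> measure_entropy f (mixture (1 - t) \<mu> \<nu>)"
      using measure_entropy_nonneg[OF \<nu>(1) f]
      by (intro measure_entropy_concave t' \<mu>(1) \<nu>(1) f less_imp_le[OF \<mu>(3)])
        (simp flip: zero_ereal_def)
    then have "ereal c \<le> measure_entropy f (mixture (1 - t) \<mu> \<nu>)"
      using t(3) by (simp add: order_trans[of "ereal c" "ereal ((1 - t) * c')"])
    ultimately show "w0 + (t * \<delta>) *\<^sub>R u
        \<in> rv \<Phi> ` {\<mu> \<in> inv_measures f. ereal c \<le> measure_entropy f \<mu>}"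
      by (metis (mono_tags, lifting) image_eqI mem_Collect_eq)
  qed
qed

text \<open>A measure near \<open>w0\<close> of large entropy would, averaged with a measure on the opposite side,
  yield one at \<open>w0\<close> itself of entropy exceeding the supremum.\<close>

lemma measure_entropy_le_near:
  fixes f :: "'a::metric_space \<Rightarrow> 'a" and \<Phi> :: "'a \<Rightarrow> real ^ 'm"
  assumes "compact (UNIV :: 'a set)" "continuous_on UNIV \<Phi>" and f: "f \<in> borel_measurable borel"
    and \<delta>: "0 < \<delta>" "cball w0 \<delta> \<subseteq> Rot f \<Phi>" and c: "loc_entropy f \<Phi> w0 < ereal c"
  obtains R where "0 < R"
    "\<And>\<mu>. \<mu> \<in> inv_measures f \<Longrightarrow> norm (rv \<Phi> \<mu> - w0) \<le> R \<Longrightarrow> measure_entropy f \<mu> \<le> ereal c"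
proof -
  obtain c0 where c0: "loc_entropy f \<Phi> w0 < ereal c0" "c0 < c"
    using ereal_dense2[OF c] by auto
  have "w0 \<in> Rot f \<Phi>"
    using \<delta> by auto
  \<comment> \<open>This makes \<open>c0\<close> and \<open>c\<close> positive, which places
    \<open>t\<close> below strictly between 0 and 1.\<close>
  then have "0 \<le> loc_entropy f \<Phi> w0"
    by (intro loc_entropy_geI) (simp add: Rot_eq_entropy_nonneg[OF f] flip: zero_ereal_def)
  with c0 have "0 < c0"
    by (metis ereal_less(2) le_less_trans)
  define t where "t = 1 - c0 / c"
  have t: "0 < t" "t < 1" and tc: "(1 - t) * c = c0"
    using \<open>0 < c0\<close> c0(2) by (auto simp: t_def)
  show thesis
  proof
    show "0 < \<delta> * t" using \<delta> t by simp
    fix \<mu> assume \<mu>: "\<mu> \<in> inv_measures f" and near: "norm (rv \<Phi> \<mu> - w0) \<le> \<delta> * t"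
    show "measure_entropy f \<mu> \<le> ereal c"
    proof (rule ccontr)
      assume "\<not> measure_entropy f \<mu> \<le> ereal c"
      then have big: "ereal c \<le> measure_entropy f \<mu>" by simp
      have "(1 - t) / t * norm (rv \<Phi> \<mu> - w0) \<le> 1 / t * (\<delta> * t)"
        using t near by (intro mult_mono divide_right_mono) auto
      \<comment> \<open>The point opposite to \<open>rv \<Phi> \<mu>\<close> for which
        \<open>w0\<close> is the average with weights \<open>1 - t\<close> and \<open>t\<close>. The
        radius \<open>\<delta> * t\<close> keeps it within \<open>\<delta>\<close> of
        \<open>w0\<close>.\<close>
      then have "w0 + ((1 - t) / t) *\<^sub>R (w0 - rv \<Phi> \<mu>) \<in> Rot f \<Phi>"
        using t by (intro subsetD[OF \<delta>(2)]) (simp add: dist_norm norm_minus_commute)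
      then obtain \<nu> where \<nu>: "\<nu> \<in> inv_measures f"
        "rv \<Phi> \<nu> = w0 + ((1 - t) / t) *\<^sub>R (w0 - rv \<Phi> \<mu>)"
        by (auto simp: Rot_def)
      have t': "0 \<le> 1 - t" "1 - t \<le> 1" using t by auto
      have "rv \<Phi> (mixture (1 - t) \<mu> \<nu>)
          = (1 - t) *\<^sub>R rv \<Phi> \<mu> + t *\<^sub>R w0 + (t * ((1 - t) / t)) *\<^sub>R (w0 - rv \<Phi> \<mu>)"
        using rv_mixture[OF assms(1,2) t' \<mu> \<nu>(1)] \<nu>(2) by (simp add: scaleR_add_right)
      also have "t * ((1 - t) / t) = 1 - t"
        using t by simp
      finally have "rv \<Phi> (mixture (1 - t) \<mu> \<nu>) = w0"
        by (simp add: algebra_simps)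
      moreover have "mixture (1 - t) \<mu> \<nu> \<in> inv_measures f"
        by (rule mixture_invariant[OF t' \<mu> \<nu>(1) f])
      moreover have "ereal ((1 - t) * c + (1 - (1 - t)) * 0) \<le> measure_entropy f (mixture (1 - t) \<mu> \<nu>)"
        using measure_entropy_nonneg[OF \<nu>(1) f]
        by (intro measure_entropy_concave t' \<mu> \<nu>(1) f big) (simp flip: zero_ereal_def)
      ultimately have "ereal c0 \<le> loc_entropy f \<Phi> w0"
        using tc by (intro loc_entropy_geI) (auto simp: image_iff intro!: bexI[of _ "mixture (1 - t) \<mu> \<nu>"])
      with c0(1) show False by simp
    qed
  qed
qed

text \<open>Here and in \<open>h_upper_leI\<close>, nonemptiness keeps the conventional values for
  the empty set away.\<close>

lemma h_lower_geI:
  assumes "cball w0 s \<inter> Rot f \<Psi> \<noteq> {}"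
    and "\<And>w. norm (w - w0) \<le> s \<Longrightarrow> w \<in> rv \<Psi> ` {\<mu> \<in> inv_measures f. c \<le> measure_entropy f \<mu>}"
  shows "c \<le> h_lower f \<Psi> w0 s"
  using assms
  by (auto simp: h_lower_def dist_norm norm_minus_commute intro!: INF_greatest loc_entropy_geI)

lemma h_upper_leI:
  assumes "cball w0 s \<inter> Rot f \<Psi> \<noteq> {}"
    and "\<And>\<mu>. \<mu> \<in> inv_measures f \<Longrightarrow> norm (rv \<Psi> \<mu> - w0) \<le> s \<Longrightarrow> measure_entropy f \<mu> \<le> c"
  shows "h_upper f \<Psi> w0 s \<le> c"
  using assms
  by (auto simp: h_upper_def loc_entropy_def dist_norm norm_minus_commute intro!: SUP_least)

lemma h_lower_le_h_upper:
  assumes "cball w0 s \<inter> Rot f \<Psi> \<noteq> {}"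
  shows "h_lower f \<Psi> w0 s \<le> h_upper f \<Psi> w0 s"
  using INF_le_SUP[OF assms, of "loc_entropy f \<Psi>"] assms by (simp add: h_lower_def h_upper_def)

theorem theorem4p3:
  fixes f :: "'a::metric_space \<Rightarrow> 'a"
    and \<Phi> :: "'a \<Rightarrow> real ^ 'm"
    and \<Phi>s :: "nat \<Rightarrow> 'a \<Rightarrow> real ^ 'm"
    and \<epsilon> :: "nat \<Rightarrow> real"
    and w0 :: "real ^ 'm"
    and \<alpha> r :: real
  assumes "compact (UNIV :: 'a set)"
    and "continuous_on UNIV f"
    and "top_entropy f < \<infinity>"
    and "upper_semicontinuous_map (weak_star f) (measure_entropy f)"
    and "continuous_on UNIV \<Phi>"
    and "approximating_sequence \<Phi> \<epsilon> \<Phi>s"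
    and "w0 \<in> interior (Rot f \<Phi>)"
    and "\<alpha> \<ge> 1"
    and "r = 2 * sqrt (real CARD('m))"
  shows "((\<lambda>n. h_lower f (\<Phi>s n) w0 (\<alpha> * \<epsilon> n)) \<longlonglongrightarrow> loc_entropy f \<Phi> w0
      \<and> (\<lambda>n. h_upper f (\<Phi>s n) w0 (\<alpha> * \<epsilon> n)) \<longlonglongrightarrow> loc_entropy f \<Phi> w0)
    \<and> (\<alpha> > r \<and> (\<forall>n. \<epsilon> (Suc n) < (\<alpha> - r) / (\<alpha> * r) * \<epsilon> n) \<longrightarrow>
        (\<exists>N. \<forall>n\<ge>N. h_lower f (\<Phi>s n) w0 (\<alpha> * \<epsilon> n)
                    \<le> h_lower f (\<Phi>s (Suc n)) w0 (\<alpha> * \<epsilon> (Suc n))))"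
proof -
  have f: "f \<in> borel_measurable borel"
    by (rule borel_measurable_continuous_onI) fact

  \<comment> \<open>Pointwise form of the approximation and nonempty intersections\<close>
  have \<epsilon>: "\<epsilon> \<longlonglongrightarrow> 0" and cont: "continuous_on UNIV (\<Phi>s n)"
    and sup: "sup_norm (\<lambda>x. \<Phi>s n x - \<Phi> x) < \<epsilon> n" for n
    using assms(6) by (auto simp: approximating_sequence_def)
  have less: "norm (\<Phi>s n x - \<Phi> x) < \<epsilon> n" for n x
  proof -
    \<comment> \<open>Compactness gives boundedness, without which the real supremum in
      \<open>sup_norm\<close> would not bound the values.\<close>
    have "compact ((\<lambda>x. norm (\<Phi>s n x - \<Phi> x)) ` UNIV)"
      by (intro compact_continuous_image continuous_intros cont assms)
    then have "bdd_above (range (\<lambda>x. norm (\<Phi>s n x - \<Phi> x)))"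
      by (intro bounded_imp_bdd_above compact_imp_bounded)
    then have "norm (\<Phi>s n x - \<Phi> x) \<le> sup_norm (\<lambda>x. \<Phi>s n x - \<Phi> x)"
      unfolding sup_norm_def by (rule cSUP_upper[OF UNIV_I])
    with sup[of n] show ?thesis by simp
  qed
  then have dist: "norm (\<Phi>s n x - \<Phi> x) \<le> \<epsilon> n" for n x
    by (rule less_imp_le)
  have pos: "0 < \<epsilon> n" for n
    using le_less_trans[OF norm_ge_zero less] .
  obtain \<delta> where \<delta>: "0 < \<delta>" "cball w0 \<delta> \<subseteq> Rot f \<Phi>"
    using assms(7) by (auto simp: mem_interior_cball)
  then have "w0 \<in> Rot f \<Phi>" by auto
  then obtain \<mu>0 where \<mu>0: "\<mu>0 \<in> inv_measures f" "rv \<Phi> \<mu>0 = w0"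
    by (auto simp: Rot_def)
  \<comment> \<open>The measure \<open>\<mu>0\<close> over \<open>w0\<close> still has rotation
    vector within \<open>\<epsilon> n\<close> of \<open>w0\<close>, and
    \<open>\<alpha> \<ge> 1\<close> puts it into the ball.\<close>
  have nonempty: "cball w0 (\<alpha> * \<epsilon> n) \<inter> Rot f (\<Phi>s n) \<noteq> {}" for n
  proof -
    have "norm (rv (\<Phi>s n) \<mu>0 - w0) \<le> \<epsilon> n"
      using rv_dist_le[OF assms(1) cont assms(5) \<mu>0(1) dist] \<mu>0(2) by metis
    also have "\<dots> \<le> \<alpha> * \<epsilon> n"
      using pos[of n] assms(8) by simp
    finally show ?thesis
      using \<mu>0(1) by (auto simp: Rot_def dist_norm norm_minus_commute)
  qed
  \<comment> \<open>The ball contributes \<open>\<alpha> * \<epsilon> n\<close> and the change of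
    potential one more \<open>\<epsilon> n\<close>.\<close>
  have small: "\<forall>\<^sub>F n in sequentially. (\<alpha> + 1) * \<epsilon> n < R" if "0 < R" for R
  proof (rule order_tendstoD(2))
    show "(\<lambda>n. (\<alpha> + 1) * \<epsilon> n) \<longlonglongrightarrow> (\<alpha> + 1) * 0"
      by (intro tendsto_intros \<epsilon>)
  qed (use that in simp)

  \<comment> \<open>Convergence of the lower and upper entropies\<close>
  let ?lo = "\<lambda>n. h_lower f (\<Phi>s n) w0 (\<alpha> * \<epsilon> n)" and ?hi = "\<lambda>n. h_upper f (\<Phi>s n) w0 (\<alpha> * \<epsilon> n)"
  have lo_hi: "?lo n \<le> ?hi n" for n
    by (rule h_lower_le_h_upper[OF nonempty])
  have lower: "\<forall>\<^sub>F n in sequentially. a < ?lo n" if a: "a < loc_entropy f \<Phi> w0" for a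
  proof -
    obtain c where c: "a < ereal c" "ereal c < loc_entropy f \<Phi> w0"
      using ereal_dense2[OF a] by auto
    obtain R where R: "0 < R" "\<And>u. norm u = 1 \<Longrightarrow>
        w0 + R *\<^sub>R u \<in> rv \<Phi> ` {\<mu> \<in> inv_measures f. ereal c \<le> measure_entropy f \<mu>}"
      using loc_entropy_lower_sphere[OF assms(1,5) f \<delta> c(2)] by blast
    show ?thesis
      using small[OF R(1)]
    proof eventually_elim
      case (elim n)
      have "ereal c \<le> ?lo n"
      proof (rule h_lower_geI[OF nonempty])
        fix w assume "norm (w - w0) \<le> \<alpha> * \<epsilon> n"
        with elim have w: "norm (w - w0) < R - \<epsilon> n"
          by (simp add: algebra_simps)
        show "w \<in> rv (\<Phi>s n) ` {\<mu> \<in> inv_measures f. ereal c \<le> measure_entropy f \<mu>}"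
          by (rule rv_entropy_ge_perturb[OF assms(1) cont assms(5) f dist R(2) w])
      qed
      with c(1) show ?case by (rule less_le_trans)
    qed
  qed
  have upper: "\<forall>\<^sub>F n in sequentially. ?hi n < a" if a: "loc_entropy f \<Phi> w0 < a" for a
  proof -
    obtain c where c: "loc_entropy f \<Phi> w0 < ereal c" "ereal c < a"
      using ereal_dense2[OF a] by auto
    obtain R where R: "0 < R"
      "\<And>\<mu>. \<mu> \<in> inv_measures f \<Longrightarrow> norm (rv \<Phi> \<mu> - w0) \<le> R \<Longrightarrow> measure_entropy f \<mu> \<le> ereal c"
      using measure_entropy_le_near[OF assms(1,5) f \<delta> c(1)] by blast
    show ?thesis
      using small[OF R(1)]
    proof eventually_elim
      case (elim n)
      have "?hi n \<le> ereal c"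
      proof (rule h_upper_leI[OF nonempty])
        fix \<mu> assume \<mu>: "\<mu> \<in> inv_measures f" "norm (rv (\<Phi>s n) \<mu> - w0) \<le> \<alpha> * \<epsilon> n"
        \<comment> \<open>The bound near \<open>w0\<close> concerns \<open>\<Phi>\<close>, so the
          measure is kept and its rotation vector is moved back from \<open>\<Phi>s n\<close> to
          \<open>\<Phi>\<close>.\<close>
        have "norm (rv \<Phi> \<mu> - w0) \<le> norm (rv \<Phi> \<mu> - rv (\<Phi>s n) \<mu>) + norm (rv (\<Phi>s n) \<mu> - w0)"
          using norm_triangle_ineq[of "rv \<Phi> \<mu> - rv (\<Phi>s n) \<mu>" "rv (\<Phi>s n) \<mu> - w0"] by simp
        moreover have "norm (rv \<Phi> \<mu> - rv (\<Phi>s n) \<mu>) \<le> \<epsilon> n"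
          using rv_dist_le[OF assms(1) cont assms(5) \<mu>(1) dist] by (simp add: norm_minus_commute)
        ultimately have "norm (rv \<Phi> \<mu> - w0) \<le> R"
          using \<mu>(2) elim by (simp add: algebra_simps)
        then show "measure_entropy f \<mu> \<le> ereal c"
          by (rule R(2)[OF \<mu>(1)])
      qed
      then show ?case using c(2) by (rule le_less_trans)
    qed
  qed
  \<comment> \<open>The missing bound on each side is inherited through
    \<open>lo_hi\<close>.\<close>
  have "?lo \<longlonglongrightarrow> loc_entropy f \<Phi> w0"
  proof (rule order_tendstoI)
    fix a assume "loc_entropy f \<Phi> w0 < a"
    from upper[OF this] show "\<forall>\<^sub>F n in sequentially. ?lo n < a"
      by eventually_elim (rule le_less_trans[OF lo_hi])
  qed (rule lower)
  moreover have "?hi \<longlonglongrightarrow> loc_entropy f \<Phi> w0"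
  proof (rule order_tendstoI)
    fix a assume "a < loc_entropy f \<Phi> w0"
    from lower[OF this] show "\<forall>\<^sub>F n in sequentially. a < ?hi n"
      by eventually_elim (rule less_le_trans[OF _ lo_hi])
  qed (rule upper)

  \<comment> \<open>Eventual monotonicity of the lower entropies\<close>
  moreover have "\<exists>N. \<forall>n\<ge>N. ?lo n \<le> ?lo (Suc n)"
    if "r < \<alpha>" and ratio: "\<And>n. \<epsilon> (Suc n) < (\<alpha> - r) / (\<alpha> * r) * \<epsilon> n"
  proof -
    have "2 \<le> r"
      using assms(9) by (simp add: Suc_leI)
    \<comment> \<open>The change from \<open>\<Phi>s n\<close> to \<open>\<Phi>s (Suc n)\<close>
      costs at most \<open>\<epsilon> n + \<epsilon> (Suc n)\<close> of the radius
      \<open>\<alpha> * \<epsilon> n\<close>; what remains still contains the next ball.\<close>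
    have gap: "\<alpha> * \<epsilon> (Suc n) < \<alpha> * \<epsilon> n - (\<epsilon> n + \<epsilon> (Suc n))" for n
    proof -
      have "(\<alpha> - r) / (\<alpha> * r) = 1 / r - 1 / \<alpha>"
        using \<open>2 \<le> r\<close> \<open>r < \<alpha>\<close> by (simp add: field_simps)
      also have "\<dots> \<le> 1 / 2 - 1 / \<alpha>"
        using \<open>2 \<le> r\<close> by (intro diff_right_mono divide_left_mono) auto
      also have "\<dots> \<le> (\<alpha> - 1) / (\<alpha> + 1)"
      proof -
        \<comment> \<open>Clearing denominators in the claimed inequality leaves exactly
          this.\<close>
        have "0 \<le> \<alpha>\<^sup>2 - \<alpha> + 2"
          using \<open>2 \<le> r\<close> \<open>r < \<alpha>\<close> self_le_power[of \<alpha> 2] by simp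
        then show ?thesis
          using \<open>2 \<le> r\<close> \<open>r < \<alpha>\<close> by (simp add: field_simps power2_eq_square)
      qed
      finally have "(\<alpha> - r) / (\<alpha> * r) * \<epsilon> n \<le> (\<alpha> - 1) / (\<alpha> + 1) * \<epsilon> n"
        using pos[of n] by (intro mult_right_mono) auto
      with ratio[of n] have "\<epsilon> (Suc n) < (\<alpha> - 1) / (\<alpha> + 1) * \<epsilon> n"
        by simp
      then show ?thesis
        using assms(8) by (simp add: field_simps)
    qed
    obtain N where N: "\<And>n. n \<ge> N \<Longrightarrow> (\<alpha> + 1) * \<epsilon> n < \<delta>"
      using small[OF \<delta>(1)] by (auto simp: eventually_sequentially)
    have "?lo n \<le> ?lo (Suc n)" if n: "n \<ge> N" for n
    proof (rule ccontr)
      assume "\<not> ?lo n \<le> ?lo (Suc n)"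
      \<comment> \<open>A level strictly below \<open>?lo n\<close> is reached by actual measures,
        even where the supremum in \<open>loc_entropy\<close> is not attained.\<close>
      then obtain c where c: "?lo (Suc n) < ereal c" "ereal c < ?lo n"
        unfolding not_le using ereal_dense2 by blast
      have sphere: "w0 + (\<alpha> * \<epsilon> n) *\<^sub>R u
          \<in> rv (\<Phi>s n) ` {\<mu> \<in> inv_measures f. ereal c \<le> measure_entropy f \<mu>}"
        if u: "norm u = 1" for u
      proof -
        let ?x = "w0 + (\<alpha> * \<epsilon> n) *\<^sub>R u"
        have x: "norm (?x - w0) = \<alpha> * \<epsilon> n"
          using u pos[of n] assms(8) by simp
        \<comment> \<open>Only vectors of the rotation set enter the infimum. Perturbation at level
          0 shows that \<open>Rot f (\<Phi>s n)\<close> contains the open ball of radius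
          \<open>\<delta> - \<epsilon> n\<close>, hence the sphere.\<close>
        have "?x \<in> Rot f (\<Phi>s n)"
          unfolding Rot_eq_entropy_nonneg[OF f]
        proof (rule rv_entropy_ge_perturb[OF assms(1) cont assms(5) f dist])
          show "norm (?x - w0) < \<delta> - \<epsilon> n"
            using N[OF n] unfolding x by (simp add: algebra_simps)
          show "w0 + \<delta> *\<^sub>R v \<in> rv \<Phi> ` {\<mu> \<in> inv_measures f. ereal 0 \<le> measure_entropy f \<mu>}"
            if "norm v = 1" for v
            unfolding Rot_eq_entropy_nonneg[OF f, symmetric]
            using that \<delta> by (intro subsetD[OF \<delta>(2)]) (simp add: dist_norm)
        qed
        then have "?lo n \<le> loc_entropy f (\<Phi>s n) ?x"
          using x nonempty[of n]
          by (auto simp: h_lower_def dist_norm intro!: INF_lower)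
        with c(2) have "ereal c < loc_entropy f (\<Phi>s n) ?x"
          by (rule less_le_trans)
        then obtain \<mu> where "\<mu> \<in> inv_measures f" "rv (\<Phi>s n) \<mu> = ?x" "ereal c < measure_entropy f \<mu>"
          unfolding loc_entropy_def less_SUP_iff by blast
        then show ?thesis
          by (auto simp: image_iff intro!: bexI[of _ \<mu>])
      qed
      have "norm (\<Phi>s (Suc n) x - \<Phi>s n x) \<le> \<epsilon> n + \<epsilon> (Suc n)" for x
        using norm_triangle_ineq4[of "\<Phi>s (Suc n) x - \<Phi> x" "\<Phi>s n x - \<Phi> x"]
          dist[of n x] dist[of "Suc n" x] by simp
      then have "w \<in> rv (\<Phi>s (Suc n)) ` {\<mu> \<in> inv_measures f. ereal c \<le> measure_entropy f \<mu>}"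
        if "norm (w - w0) \<le> \<alpha> * \<epsilon> (Suc n)" for w
        by (rule rv_entropy_ge_perturb[OF assms(1) cont cont f _ sphere le_less_trans[OF that gap]])
      then have "ereal c \<le> ?lo (Suc n)"
        by (rule h_lower_geI[OF nonempty])
      with c(1) show False by simp
    qed
    then show ?thesis by blast
  qed
  ultimately show ?thesis by blast
qed

end
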